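(* Let $X$ be a Banach space, $\mathbb{N}'\subset\mathbb{N}$ infinite, and let $(M_n)_{n\in\mathbb{N}'}$ and $(P_n)_{n\in\mathbb{N}'}$ be sequences of closed subspaces of $X$ with $M_n\neq\{\theta\}$ for all $n\in\mathbb{N}'$. Then the numbers $\mathcal{SS}\lambda_{\mathbb{N}'}[M_n,P_n]$ and $\mathcal{FSS}\lambda_{\mathbb{N}'}[M_n,P_n]$ are well defined (the sets whose infima define them are nonempty) and $$0\le\min(\mathcal{SS}\lambda_{\mathbb{N}'}[M_n,P_n],\mathcal{FSS}\lambda_{\mathbb{N}'}[M_n,P_n])\le\max(\mathcal{SS}\lambda_{\mathbb{N}'}[M_n,P_n],\mathcal{FSS}\lambda_{\mathbb{N}'}[M_n,P_n])\le\lambda_{\mathbb{N}'}[M_n,P_n]\le1.$$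
   Context: Conventions: $\mathbb{N}'$ is an infinite subset of $\mathbb{N}$, $\mathbb{N}''$ an infinite subset of $\mathbb{N}'$, $\mathbb{N}'''$ an infinite subset of $\mathbb{N}''$, etc.; limits are taken along these index sets. $\theta$ is the null element. Dimensions are finite numbers or $\infty$. Uniform $\lambda$-adjustment. Let $(M_n)_{\mathbb{N}'}$, $(P_n)_{\mathbb{N}'}$ be sequences of closed subspaces of a Banach space $X$ with $M_n\neq\{\theta\}$ for all $n$, and let $\lambda\ge 0$. $(M_n)_{\mathbb{N}'}$ is lower uniformly $\lambda$-adjusted with $(P_n)_{\mathbb{N}'}$ if for every $\eta>0$, every infinite $\mathbb{N}''\subset\mathbb{N}'$ and all unit vectors $x_n\in M_n$ ($n\in\mathbb{N}''$), there exist an infinite $\mathbb{N}'''\subset\mathbb{N}''$, vectors $y_n\in P_n$ ($n\in\mathbb{N}'''$) and a vector $z\in X$ such that $\varlimsup_{n\in\mathbb{N}'''}\|x_n-y_n-z\|\le\lambda+\eta$. $\lambda_{\mathbb{N}'}[M_n,P_n]$ is the infimum of all such $\lambda$. Strictly singular uniform $\lambda$-adjustment. For the same data, $\mathcal{SS}\lambda_{\mathbb{N}'}[M_n,P_n]$ is the infimum of all $\lambda\ge0$ such that: for every infinite $\mathbb{N}''\subset\mathbb{N}'$ and all closed subspaces $K_n\subset M_n$ with $\dim K_n=\infty$ ($n\in\mathbb{N}''$), there exist an infinite $\mathbb{N}'''\subset\mathbb{N}''$ and closed subspaces $L_n\subset K_n$ with $\dim L_n=\infty$ ($n\in\mathbb{N}'''$)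 such that $\lambda_{\mathbb{N}'''}[L_n,P_n]\le\lambda$. Finitely strictly singular uniform $\lambda$-adjustment. $\mathcal{FSS}\lambda_{\mathbb{N}'}[M_n,P_n]$ is the infimum of all $\lambda\ge0$ such that: for every infinite $\mathbb{N}''\subset\mathbb{N}'$ and all subspaces $K_n\subset M_n$ with $\dim K_n<\infty$ ($n\in\mathbb{N}''$) and $\lim_{n\in\mathbb{N}''}\dim K_n=\infty$, there exist an infinite $\mathbb{N}'''\subset\mathbb{N}''$ and nonzero subspaces $L_n\subset K_n$ ($n\in\mathbb{N}'''$) with $\lim_{n\in\mathbb{N}'''}\dim L_n=\infty$ and $\lambda_{\mathbb{N}'''}[L_n,P_n]\le\lambda$. *)

theory Defs
  imports "HOL-Analysis.Analysis"
begin

text \<open>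
  A Banach space over the real or complex field. The class \<open>banach\<close> supplies the norm, its
  completeness and the underlying real structure; the scalar multiplication \<open>scale\<close> says over
  which field subspaces and dimensions are taken. The only instances of
  \<open>real_normed_field\<close> are, up to isomorphism, the real and the complex numbers.
\<close>

locale banach_over = vector_space scale
  for scale :: "'k::real_normed_field \<Rightarrow> 'x::banach \<Rightarrow> 'x" +
  assumes scale_of_real: "scale (of_real r) x = r *\<^sub>R x"
    and norm_scale: "norm (scale a x) = norm a * norm x"

lemma banach_over_scaleR: "banach_over (scaleR :: real \<Rightarrow> 'x::banach \<Rightarrow> 'x)"
  by unfold_locales (auto simp: algebra_simps)

lemma banach_over_complex: "banach_over ((*) :: complex \<Rightarrow> complex \<Rightarrow> complex)"
  by unfold_locales (auto simp: algebra_simps norm_mult scaleR_conv_of_real)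

text \<open>
  A sequence indexed by an infinite set \<open>N\<close> of naturals is a function on \<open>nat\<close> of which only
  the values on \<open>N\<close> matter; limits along \<open>N\<close> are limits with respect to the following filter.
\<close>

definition along :: "nat set \<Rightarrow> nat filter" where
  "along N = inf sequentially (principal N)"

definition lower_unif_adjusted ::
  "real \<Rightarrow> nat set \<Rightarrow> (nat \<Rightarrow> 'x::banach set) \<Rightarrow> (nat \<Rightarrow> 'x set) \<Rightarrow> bool" where
  "lower_unif_adjusted c N M P \<longleftrightarrow>
    (\<forall>\<eta>>0. \<forall>N2 x. N2 \<subseteq> N \<longrightarrow> infinite N2 \<longrightarrow> (\<forall>n\<in>N2. x n \<in> M n \<and> norm (x n) = 1) \<longrightarrow>
      (\<exists>N3 y z. N3 \<subseteq> N2 \<and> infinite N3 \<and> (\<forall>n\<in>N3. y n \<in> P n) \<and>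
        Limsup (along N3) (\<lambda>n. ereal (norm (x n - y n - z))) \<le> ereal (c + \<eta>)))"

text \<open>
  The set below is bounded below by 0 and, if every \<open>P n\<close> contains 0, it contains 1
  (take \<open>y n = 0\<close> and \<open>z = 0\<close>), so its real infimum is then the genuine one.
\<close>

definition unif_adj :: "nat set \<Rightarrow> (nat \<Rightarrow> 'x::banach set) \<Rightarrow> (nat \<Rightarrow> 'x set) \<Rightarrow> real" where
  "unif_adj N M P = Inf {c. 0 \<le> c \<and> lower_unif_adjusted c N M P}"

context banach_over
begin

definition closed_subspace :: "'x set \<Rightarrow> bool" where
  "closed_subspace S \<longleftrightarrow> subspace S \<and> closed S"

text \<open>
  The library's \<open>dim\<close> is 0 on subspaces without a finite basis, so infinite dimension has to be
  told apart explicitly.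
\<close>

definition edim :: "'x set \<Rightarrow> enat" where
  "edim S = (if \<exists>B. finite B \<and> S \<subseteq> span B then enat (dim S) else \<infinity>)"

definition SS_adj_set :: "nat set \<Rightarrow> (nat \<Rightarrow> 'x set) \<Rightarrow> (nat \<Rightarrow> 'x set) \<Rightarrow> real set" where
  "SS_adj_set N M P = {c. 0 \<le> c \<and>
    (\<forall>N2 K. N2 \<subseteq> N \<longrightarrow> infinite N2 \<longrightarrow>
      (\<forall>n\<in>N2. closed_subspace (K n) \<and> K n \<subseteq> M n \<and> edim (K n) = \<infinity>) \<longrightarrow>
      (\<exists>N3 L. N3 \<subseteq> N2 \<and> infinite N3 \<and>
        (\<forall>n\<in>N3. closed_subspace (L n) \<and> L n \<subseteq> K n \<and> edim (L n) = \<infinity>) \<and>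
        unif_adj N3 L P \<le> c))}"

definition SS_unif_adj :: "nat set \<Rightarrow> (nat \<Rightarrow> 'x set) \<Rightarrow> (nat \<Rightarrow> 'x set) \<Rightarrow> real" where
  "SS_unif_adj N M P = Inf (SS_adj_set N M P)"

definition FSS_adj_set :: "nat set \<Rightarrow> (nat \<Rightarrow> 'x set) \<Rightarrow> (nat \<Rightarrow> 'x set) \<Rightarrow> real set" where
  "FSS_adj_set N M P = {c. 0 \<le> c \<and>
    (\<forall>N2 K. N2 \<subseteq> N \<longrightarrow> infinite N2 \<longrightarrow>
      (\<forall>n\<in>N2. subspace (K n) \<and> K n \<subseteq> M n \<and> edim (K n) < \<infinity>) \<longrightarrow>
      ((\<lambda>n. edim (K n)) \<longlongrightarrow> \<infinity>) (along N2) \<longrightarrow>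
      (\<exists>N3 L. N3 \<subseteq> N2 \<and> infinite N3 \<and>
        (\<forall>n\<in>N3. subspace (L n) \<and> L n \<subseteq> K n \<and> L n \<noteq> {0}) \<and>
        ((\<lambda>n. edim (L n)) \<longlongrightarrow> \<infinity>) (along N3) \<and>
        unif_adj N3 L P \<le> c))}"

definition FSS_unif_adj :: "nat set \<Rightarrow> (nat \<Rightarrow> 'x set) \<Rightarrow> (nat \<Rightarrow> 'x set) \<Rightarrow> real" where
  "FSS_unif_adj N M P = Inf (FSS_adj_set N M P)"

end

end

theory Submission imports Defs begin

text \<open>
  Shrinking the index set or the spaces \<open>M n\<close> can only decrease the uniform adjustment. Hence
  \<open>L = K\<close> witnesses that \<open>unif_adj N M P\<close> itself belongs to both sets of admissible constants; in
  the finitely strictly singular case the finitely many indices with \<open>K n = {0}\<close> are dropped.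
\<close>

lemma along_mono: "A \<subseteq> B \<Longrightarrow> along A \<le> along B"
  unfolding along_def by (intro inf_mono) auto

text \<open>On the naturals \<open>sequentially\<close> is the cofinite filter, so restricting it to
  \<open>N\<close> leaves only the exceptions inside \<open>N\<close> to be counted. This form lets
  a limit along \<open>N\<close> bound a set of bad indices.\<close>

lemma eventually_along_iff: "eventually Q (along N) \<longleftrightarrow> finite {n \<in> N. \<not> Q n}"
proof -
  have "eventually Q (along N) \<longleftrightarrow> eventually (\<lambda>n. n \<in> N \<longrightarrow> Q n) cofinite"
    by (simp only: along_def eventually_inf_principal cofinite_eq_sequentially)
  then show ?thesis
    by (simp only: eventually_cofinite not_imp)
qed

text \<open>Every test sequence of unit vectors for the smaller data is also one for the larger
  data, and since \<open>P\<close> is the same, the \<open>N3\<close>, \<open>y\<close> and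
  \<open>z\<close> found there serve unchanged.\<close>

lemma lower_unif_adjusted_mono:
  assumes "lower_unif_adjusted c N M P" "N' \<subseteq> N" "\<And>n. n \<in> N' \<Longrightarrow> M' n \<subseteq> M n"
  shows "lower_unif_adjusted c N' M' P"
  unfolding lower_unif_adjusted_def
proof (intro allI impI)
  fix \<eta> :: real and N2 and x :: "nat \<Rightarrow> 'a"
  assume "0 < \<eta>" "N2 \<subseteq> N'" "infinite N2" "\<forall>n\<in>N2. x n \<in> M' n \<and> norm (x n) = 1"
  then have "N2 \<subseteq> N" "\<forall>n\<in>N2. x n \<in> M n \<and> norm (x n) = 1"
    using assms(2,3) by blast+
  with \<open>0 < \<eta>\<close> \<open>infinite N2\<close> show "\<exists>N3 y z. N3 \<subseteq> N2 \<and> infinite N3 \<and>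
      (\<forall>n\<in>N3. y n \<in> P n) \<and>
      Limsup (along N3) (\<lambda>n. ereal (norm (x n - y n - z))) \<le> ereal (c + \<eta>)"
    using assms(1)[unfolded lower_unif_adjusted_def, rule_format, of \<eta> N2 x] by simp
qed

lemma lower_unif_adjusted_1:
  assumes "\<And>n. n \<in> N \<Longrightarrow> 0 \<in> P n"
  shows "lower_unif_adjusted 1 N M P"
  unfolding lower_unif_adjusted_def
proof (intro allI impI)
  fix \<eta> :: real and N2 and x :: "nat \<Rightarrow> 'a"
  assume *: "0 < \<eta>" "N2 \<subseteq> N" "infinite N2" "\<forall>n\<in>N2. x n \<in> M n \<and> norm (x n) = 1"
  \<comment> \<open>The zeros stand for the witnesses \<open>y n = 0\<close> and
    \<open>z = 0\<close>; the norm is then 1 at every index of \<open>N2\<close>, so no thinning is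
    required.\<close>
  have "eventually (\<lambda>n. ereal (norm (x n - 0 - 0)) \<le> ereal (1 + \<eta>)) (along N2)"
    using * by (auto simp: along_def eventually_inf_principal)
  then have "Limsup (along N2) (\<lambda>n. ereal (norm (x n - 0 - 0))) \<le> ereal (1 + \<eta>)"
    by (rule Limsup_bounded)
  moreover have "\<forall>n\<in>N2. 0 \<in> P n"
    using * assms by blast
  ultimately show "\<exists>N3 y z. N3 \<subseteq> N2 \<and> infinite N3 \<and> (\<forall>n\<in>N3. y n \<in> P n) \<and>
      Limsup (along N3) (\<lambda>n. ereal (norm (x n - y n - z))) \<le> ereal (1 + \<eta>)"
    using * by (intro exI[of _ N2] exI[of _ "\<lambda>_. 0"] exI[of _ 0]) auto
qed

text \<open>A real \<open>Inf\<close> is only controlled on nonempty sets, so the lower bound 0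
  passes to it once the constant 1 is known to be admissible.\<close>

lemma unif_adj_nonneg:
  assumes "\<And>n. n \<in> N \<Longrightarrow> 0 \<in> P n"
  shows "0 \<le> unif_adj N M P"
  unfolding unif_adj_def
proof (rule cInf_greatest)
  show "{c. 0 \<le> c \<and> lower_unif_adjusted c N M P} \<noteq> {}"
    using lower_unif_adjusted_1[where N = N and M = M and P = P, OF assms] zero_le_one by blast
qed simp

lemma unif_adj_le_1:
  assumes "\<And>n. n \<in> N \<Longrightarrow> 0 \<in> P n"
  shows "unif_adj N M P \<le> 1"
  unfolding unif_adj_def
  by (rule cInf_lower) (use lower_unif_adjusted_1[where N = N and M = M and P = P, OF assms] in \<open>auto intro: bdd_belowI[of _ 0]\<close>)

text \<open>Fewer test sequences admit more constants, and the infimum of a larger set is smaller.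
  For real infima this takes a nonempty smaller set (it contains 1) and a larger set bounded below
  (by 0).\<close>

lemma unif_adj_mono:
  assumes "\<And>n. n \<in> N \<Longrightarrow> 0 \<in> P n" "N' \<subseteq> N" "\<And>n. n \<in> N' \<Longrightarrow> M' n \<subseteq> M n"
  shows "unif_adj N' M' P \<le> unif_adj N M P"
  unfolding unif_adj_def
proof (rule cInf_superset_mono)
  show "{c. 0 \<le> c \<and> lower_unif_adjusted c N M P} \<noteq> {}"
    using lower_unif_adjusted_1[where N = N and M = M and P = P, OF assms(1)] zero_le_one by blast
  show "bdd_below {c. 0 \<le> c \<and> lower_unif_adjusted c N' M' P}"
    by (auto intro: bdd_belowI[of _ 0])
  show "{c. 0 \<le> c \<and> lower_unif_adjusted c N M P} \<subseteq> {c. 0 \<le> c \<and> lower_unif_adjusted c N' M' P}"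
    using lower_unif_adjusted_mono[where M = M and M' = M', OF _ assms(2,3)] by blast
qed

context banach_over
begin

lemma edim_zero: "edim {0} = 0"
proof -
  have "dim {0} = 0"
    using dim_eq_card[of "{}" "{0}"] independent_empty by simp
  then show ?thesis
    by (auto simp: edim_def zero_enat_def intro!: exI[of _ "{}"])
qed

lemma unif_adj_in_SS_adj_set:
  assumes "\<And>n. n \<in> N \<Longrightarrow> 0 \<in> P n"
  shows "unif_adj N M P \<in> SS_adj_set N M P"
  unfolding SS_adj_set_def
proof (intro CollectI conjI allI impI)
  show "0 \<le> unif_adj N M P"
    using assms by (rule unif_adj_nonneg)
  fix N2 K
  assume "N2 \<subseteq> N" "infinite N2"
    and "\<forall>n\<in>N2. closed_subspace (K n) \<and> K n \<subseteq> M n \<and> edim (K n) = \<infinity>"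
  then show "\<exists>N3 L. N3 \<subseteq> N2 \<and> infinite N3 \<and>
      (\<forall>n\<in>N3. closed_subspace (L n) \<and> L n \<subseteq> K n \<and> edim (L n) = \<infinity>) \<and>
      unif_adj N3 L P \<le> unif_adj N M P"
    using unif_adj_mono[where N = N and P = P and N' = N2 and M' = K and M = M] assms by (intro exI[of _ N2] exI[of _ K]) auto
qed

lemma unif_adj_in_FSS_adj_set:
  assumes "\<And>n. n \<in> N \<Longrightarrow> 0 \<in> P n"
  shows "unif_adj N M P \<in> FSS_adj_set N M P"
  unfolding FSS_adj_set_def
proof (intro CollectI conjI allI impI)
  show "0 \<le> unif_adj N M P"
    using assms by (rule unif_adj_nonneg)
  fix N2 K
  assume N2: "N2 \<subseteq> N" "infinite N2"
    and K: "\<forall>n\<in>N2. subspace (K n) \<and> K n \<subseteq> M n \<and> edim (K n) < \<infinity>"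
    and lim: "((\<lambda>n. edim (K n)) \<longlongrightarrow> \<infinity>) (along N2)"
  define N3 where "N3 = {n \<in> N2. 0 < edim (K n)}"
  \<comment> \<open>A limit \<infinity> makes the dimensions eventually exceed 0, hence all but
    finitely many indices of \<open>N2\<close> survive in \<open>N3\<close>.\<close>
  have "finite {n \<in> N2. \<not> 0 < edim (K n)}"
    using order_tendstoD(1)[OF lim, of 0] unfolding eventually_along_iff by simp
  moreover have "N2 = N3 \<union> {n \<in> N2. \<not> 0 < edim (K n)}"
    by (auto simp: N3_def)
  ultimately have "infinite N3"
    using \<open>infinite N2\<close> by (metis finite_Un)
  moreover have "N3 \<subseteq> N2"
    by (auto simp: N3_def)
  \<comment> \<open>\<open>edim_zero\<close> is used contrapositively: positive dimension excludes
    \<open>{0}\<close>.\<close>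
  moreover have "\<forall>n\<in>N3. subspace (K n) \<and> K n \<subseteq> K n \<and> K n \<noteq> {0}"
    using K edim_zero by (force simp: N3_def)
  \<comment> \<open>\<open>along N3\<close> is a finer filter than \<open>along N2\<close>, so the
    limit passes to the subsequence.\<close>
  moreover have "((\<lambda>n. edim (K n)) \<longlongrightarrow> \<infinity>) (along N3)"
    using lim along_mono[OF \<open>N3 \<subseteq> N2\<close>] by (rule tendsto_mono[rotated])
  moreover have "unif_adj N3 K P \<le> unif_adj N M P"
    using assms N2 K \<open>N3 \<subseteq> N2\<close> by (intro unif_adj_mono) auto
  ultimately show "\<exists>N3 L. N3 \<subseteq> N2 \<and> infinite N3 \<and>
      (\<forall>n\<in>N3. subspace (L n) \<and> L n \<subseteq> K n \<and> L n \<noteq> {0}) \<and>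
      ((\<lambda>n. edim (L n)) \<longlongrightarrow> \<infinity>) (along N3) \<and>
      unif_adj N3 L P \<le> unif_adj N M P"
    by blast
qed

end

theorem lemma3p3p2:
  fixes scale :: "'k::real_normed_field \<Rightarrow> 'x::banach \<Rightarrow> 'x"
    and N :: "nat set" and M P :: "nat \<Rightarrow> 'x set"
  assumes "banach_over scale"
    and "infinite N"
    and "\<And>n. n \<in> N \<Longrightarrow> banach_over.closed_subspace scale (M n)"
    and "\<And>n. n \<in> N \<Longrightarrow> banach_over.closed_subspace scale (P n)"
    and "\<And>n. n \<in> N \<Longrightarrow> M n \<noteq> {0}"
  shows "banach_over.SS_adj_set scale N M P \<noteq> {}
    \<and> banach_over.FSS_adj_set scale N M P \<noteq> {}
    \<and> 0 \<le> min (banach_over.SS_unif_adj scale N M P) (banach_over.FSS_unif_adj scale N M P)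
    \<and> min (banach_over.SS_unif_adj scale N M P) (banach_over.FSS_unif_adj scale N M P)
        \<le> max (banach_over.SS_unif_adj scale N M P) (banach_over.FSS_unif_adj scale N M P)
    \<and> max (banach_over.SS_unif_adj scale N M P) (banach_over.FSS_unif_adj scale N M P)
        \<le> unif_adj N M P
    \<and> unif_adj N M P \<le> 1"
proof -
  interpret banach_over scale by fact
  have P: "0 \<in> P n" if "n \<in> N" for n
    using assms(4)[OF that] by (auto simp: closed_subspace_def subspace_def)
  \<comment> \<open>Each membership does double duty: it makes the set nonempty, so that 0 is a
    lower bound of the infimum, and it bounds that infimum above by
    \<open>unif_adj N M P\<close>.\<close>
  note SS = unif_adj_in_SS_adj_set[where N = N and M = M and P = P, OF P]
  note FSS = unif_adj_in_FSS_adj_set[where N = N and M = M and P = P, OF P]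
  have nonneg: "0 \<le> c" if "c \<in> SS_adj_set N M P \<union> FSS_adj_set N M P" for c
    using that unfolding SS_adj_set_def FSS_adj_set_def by blast
  then have bdd: "bdd_below (SS_adj_set N M P)" "bdd_below (FSS_adj_set N M P)"
    by (meson UnI1 UnI2 bdd_belowI)+
  have "0 \<le> SS_unif_adj N M P"
    unfolding SS_unif_adj_def using SS nonneg by (intro cInf_greatest) blast+
  moreover have "0 \<le> FSS_unif_adj N M P"
    unfolding FSS_unif_adj_def using FSS nonneg by (intro cInf_greatest) blast+
  moreover have "SS_unif_adj N M P \<le> unif_adj N M P"
    unfolding SS_unif_adj_def using SS bdd(1) by (rule cInf_lower)
  moreover have "FSS_unif_adj N M P \<le> unif_adj N M P"
    unfolding FSS_unif_adj_def using FSS bdd(2) by (rule cInf_lower)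
  moreover have "unif_adj N M P \<le> 1"
    using P by (rule unif_adj_le_1)
  ultimately show ?thesis
    using SS FSS by auto
qed

end
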